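(* Let $P\colon\mathcal{E}\to\mathcal{B}$ be a functor between small categories. Let $E_P=P\downarrow1_{\mathcal{B}}$ be the comma category, and let $P=P_2\circ P_1$ be the factorization $\mathcal{E}\xrightarrow{P_1}E_P\xrightarrow{P_2}\mathcal{B}$ with $P_1(e)=(e,1_{P(e)}\colon P(e)\to P(e))$ and $P_2(e,h\colon P(e)\to b)=b$. Then $$\mathrm{dsecat}(P)=\mathrm{dsecat}(P_2)=\mathrm{secat}(P_2).$$
   Context: All categories are small. The objects of $E_P=P\downarrow 1_{\mathcal{B}}$ are pairs consisting of $e\in\mathcal{E}$ and a morphism $h\colon P(e)\to b$ in $\mathcal{B}$; a morphism from $h\colon P(e)\to b$ to $h'\colon P(e')\to b'$ is a pair $(g,u)$ with $g\colon e\to e'$ in $\mathcal{E}$ and $u\colon b\to b'$ in $\mathcal{B}$ such that $u h=h'P(g)$. On morphisms, $P_1(g)=(g,P(g))$ and $P_2(g,u)=u$. A cover of a category $\mathcal{B}$ is a family of (not necessarily full) subcategories such that every morphism of $\mathcal{B}$ belongs to at least one of them. For a functor $Q\colon\mathcal{E}\to\mathcal{B}$, $\mathrm{secat}(Q)$ (resp. $\mathrm{dsecat}(Q)$) is the least integer $n\geq0$ for which $\mathcal{B}$ admits a cover $\{\mathcal{U}_0,\dots,\mathcal{U}_n\}$ and, for every $i$, a functor $s_i\colon\mathcal{U}_i\to\mathcal{E}$ with $Q s_i=\iota_i$ (resp. together with a natural transformation $Q s_i\Rightarrow\iota_i$), where $\iota_i\colon\mathcal{U}_i\hookrightarrow\mathcal{B}$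 is the inclusion; it is $\infty$ if no such finite cover exists. *)

theory Defs
  imports Main "HOL-Library.Extended_Nat"
begin

section \<open>Small categories, functors, natural transformations\<close>

text \<open>
  A small category is a record of carrier sets and structure maps. The structure maps are total
  functions; only their values on the carriers (and of composition on composable pairs) matter.
  \<open>Comp C g f\<close> is the composite \<open>g f\<close>, first \<open>f\<close>, then \<open>g\<close>.
\<close>

record ('o, 'a) cat =
  Obj :: "'o set"
  Arr :: "'a set"
  Src :: "'a \<Rightarrow> 'o"
  Tgt :: "'a \<Rightarrow> 'o"
  Idt :: "'o \<Rightarrow> 'a"
  Comp :: "'a \<Rightarrow> 'a \<Rightarrow> 'a"

locale category =
  fixes C :: "('o, 'a) cat"
  assumes Src_Obj: "f \<in> Arr C \<Longrightarrow> Src C f \<in> Obj C"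
    and Tgt_Obj: "f \<in> Arr C \<Longrightarrow> Tgt C f \<in> Obj C"
    and Idt_Arr: "x \<in> Obj C \<Longrightarrow> Idt C x \<in> Arr C"
    and Src_Idt: "x \<in> Obj C \<Longrightarrow> Src C (Idt C x) = x"
    and Tgt_Idt: "x \<in> Obj C \<Longrightarrow> Tgt C (Idt C x) = x"
    and Comp_Arr: "\<lbrakk>f \<in> Arr C; g \<in> Arr C; Src C g = Tgt C f\<rbrakk> \<Longrightarrow> Comp C g f \<in> Arr C"
    and Src_Comp: "\<lbrakk>f \<in> Arr C; g \<in> Arr C; Src C g = Tgt C f\<rbrakk> \<Longrightarrow> Src C (Comp C g f) = Src C f"
    and Tgt_Comp: "\<lbrakk>f \<in> Arr C; g \<in> Arr C; Src C g = Tgt C f\<rbrakk> \<Longrightarrow> Tgt C (Comp C g f) = Tgt C g"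
    and Comp_Idt_right: "f \<in> Arr C \<Longrightarrow> Comp C f (Idt C (Src C f)) = f"
    and Comp_Idt_left: "f \<in> Arr C \<Longrightarrow> Comp C (Idt C (Tgt C f)) f = f"
    and Comp_assoc: "\<lbrakk>f \<in> Arr C; g \<in> Arr C; h \<in> Arr C; Src C g = Tgt C f; Src C h = Tgt C g\<rbrakk>
      \<Longrightarrow> Comp C h (Comp C g f) = Comp C (Comp C h g) f"

record ('o, 'a, 'p, 'b) fctr =
  omap :: "'o \<Rightarrow> 'p"
  amap :: "'a \<Rightarrow> 'b"

locale cat_functor = C: category C + D: category D
  for C :: "('o, 'a) cat" and D :: "('p, 'b) cat" +
  fixes F :: "('o, 'a, 'p, 'b) fctr"
  assumes omap_Obj: "x \<in> Obj C \<Longrightarrow> omap F x \<in> Obj D"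
    and amap_Arr: "f \<in> Arr C \<Longrightarrow> amap F f \<in> Arr D"
    and Src_amap: "f \<in> Arr C \<Longrightarrow> Src D (amap F f) = omap F (Src C f)"
    and Tgt_amap: "f \<in> Arr C \<Longrightarrow> Tgt D (amap F f) = omap F (Tgt C f)"
    and amap_Idt: "x \<in> Obj C \<Longrightarrow> amap F (Idt C x) = Idt D (omap F x)"
    and amap_Comp: "\<lbrakk>f \<in> Arr C; g \<in> Arr C; Src C g = Tgt C f\<rbrakk>
      \<Longrightarrow> amap F (Comp C g f) = Comp D (amap F g) (amap F f)"

definition fctr_comp ::
    "('p, 'b, 'q, 'c) fctr \<Rightarrow> ('o, 'a, 'p, 'b) fctr \<Rightarrow> ('o, 'a, 'q, 'c) fctr"
    (infixl "\<circ>\<^sub>F" 55) where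
  "G \<circ>\<^sub>F F = \<lparr>omap = omap G \<circ> omap F, amap = amap G \<circ> amap F\<rparr>"

text \<open>Equality of functors with domain \<open>C\<close>: values off the carriers of \<open>C\<close> are ignored.\<close>

definition fctr_eq ::
    "('o, 'a) cat \<Rightarrow> ('o, 'a, 'p, 'b) fctr \<Rightarrow> ('o, 'a, 'p, 'b) fctr \<Rightarrow> bool" where
  "fctr_eq C F G \<longleftrightarrow>
    (\<forall>x\<in>Obj C. omap F x = omap G x) \<and> (\<forall>f\<in>Arr C. amap F f = amap G f)"

locale nat_transf = F: cat_functor C D F + G: cat_functor C D G
  for C :: "('o, 'a) cat" and D :: "('p, 'b) cat"
    and F G :: "('o, 'a, 'p, 'b) fctr" +
  fixes \<tau> :: "'o \<Rightarrow> 'b"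
  assumes \<tau>_Arr: "x \<in> Obj C \<Longrightarrow> \<tau> x \<in> Arr D"
    and Src_\<tau>: "x \<in> Obj C \<Longrightarrow> Src D (\<tau> x) = omap F x"
    and Tgt_\<tau>: "x \<in> Obj C \<Longrightarrow> Tgt D (\<tau> x) = omap G x"
    and naturality: "f \<in> Arr C
      \<Longrightarrow> Comp D (\<tau> (Tgt C f)) (amap F f) = Comp D (amap G f) (\<tau> (Src C f))"


section \<open>Covers by subcategories and sectional categories\<close>

definition subcategory :: "('o, 'a) cat \<Rightarrow> ('o, 'a) cat \<Rightarrow> bool" where
  "subcategory U B \<longleftrightarrow> category U \<and> category B \<and> Obj U \<subseteq> Obj B \<and> Arr U \<subseteq> Arr B
    \<and> (\<forall>f\<in>Arr U. Src U f = Src B f \<and> Tgt U f = Tgt B f)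
    \<and> (\<forall>x\<in>Obj U. Idt U x = Idt B x)
    \<and> (\<forall>f\<in>Arr U. \<forall>g\<in>Arr U. Src U g = Tgt U f \<longrightarrow> Comp U g f = Comp B g f)"

text \<open>The inclusion functor of any subcategory is given by the identity maps.\<close>

definition incl :: "('o, 'a, 'o, 'a) fctr" where
  "incl = \<lparr>omap = (\<lambda>x. x), amap = (\<lambda>f. f)\<rparr>"

definition is_cover :: "('o, 'a) cat \<Rightarrow> 'i set \<Rightarrow> ('i \<Rightarrow> ('o, 'a) cat) \<Rightarrow> bool" where
  "is_cover B I U \<longleftrightarrow> (\<forall>i\<in>I. subcategory (U i) B) \<and> (\<forall>f\<in>Arr B. \<exists>i\<in>I. f \<in> Arr (U i))"

text \<open>In the next two definitions the infimum of the empty set is \<open>\<infinity>\<close>.\<close>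

definition secat ::
    "('p, 'b) cat \<Rightarrow> ('o, 'a) cat \<Rightarrow> ('p, 'b, 'o, 'a) fctr \<Rightarrow> enat" where
  "secat E B Q = Inf {enat n | n. \<exists>U. is_cover B {0..n} U \<and>
    (\<forall>i\<in>{0..n}. \<exists>s. cat_functor (U i) E s \<and> fctr_eq (U i) (Q \<circ>\<^sub>F s) incl)}"

definition dsecat ::
    "('p, 'b) cat \<Rightarrow> ('o, 'a) cat \<Rightarrow> ('p, 'b, 'o, 'a) fctr \<Rightarrow> enat" where
  "dsecat E B Q = Inf {enat n | n. \<exists>U. is_cover B {0..n} U \<and>
    (\<forall>i\<in>{0..n}. \<exists>s. cat_functor (U i) E s \<and> (\<exists>\<tau>. nat_transf (U i) B (Q \<circ>\<^sub>F s) incl \<tau>))}"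


section \<open>The comma category of a functor over the identity\<close>

text \<open>
  An object \<open>h : P(e) \<rightarrow> b\<close> is encoded as \<open>(e, h)\<close>, with \<open>b = Tgt B h\<close>. Since the commutation
  condition on \<open>(g, u)\<close> does not determine \<open>h\<close> and \<open>h'\<close>, an arrow carries its source and target
  as well and is encoded as \<open>((e, h), (g, u), (e', h'))\<close>.
\<close>

type_synonym ('o, 'b) comma_obj = "'o \<times> 'b"
type_synonym ('o, 'a, 'b) comma_arr =
  "('o, 'b) comma_obj \<times> ('a \<times> 'b) \<times> ('o, 'b) comma_obj"

definition comma_cat ::
    "('o, 'a) cat \<Rightarrow> ('p, 'b) cat \<Rightarrow> ('o, 'a, 'p, 'b) fctr
      \<Rightarrow> (('o, 'b) comma_obj, ('o, 'a, 'b) comma_arr) cat" where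
  "comma_cat E B P =
    (let Ob = {(e, h). e \<in> Obj E \<and> h \<in> Arr B \<and> Src B h = omap P e} in
    \<lparr>Obj = Ob,
     Arr = {((e, h), (g, u), (e', h')).
       (e, h) \<in> Ob \<and> (e', h') \<in> Ob
       \<and> g \<in> Arr E \<and> Src E g = e \<and> Tgt E g = e'
       \<and> u \<in> Arr B \<and> Src B u = Tgt B h \<and> Tgt B u = Tgt B h'
       \<and> Comp B u h = Comp B h' (amap P g)},
     Src = (\<lambda>(x, _, _). x),
     Tgt = (\<lambda>(_, _, y). y),
     Idt = (\<lambda>(e, h). ((e, h), (Idt E e, Idt B (Tgt B h)), (e, h))),
     Comp = (\<lambda>(_, (g', u'), z) (x, (g, u), _). (x, (Comp E g' g, Comp B u' u), z))\<rparr>)"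

definition comma_P1 ::
    "('o, 'a) cat \<Rightarrow> ('p, 'b) cat \<Rightarrow> ('o, 'a, 'p, 'b) fctr
      \<Rightarrow> ('o, 'a, ('o, 'b) comma_obj, ('o, 'a, 'b) comma_arr) fctr" where
  "comma_P1 E B P =
    (let ob = (\<lambda>e. (e, Idt B (omap P e))) in
    \<lparr>omap = ob, amap = (\<lambda>g. (ob (Src E g), (g, amap P g), ob (Tgt E g)))\<rparr>)"

definition comma_P2 ::
    "('p, 'b) cat \<Rightarrow> (('o, 'b) comma_obj, ('o, 'a, 'b) comma_arr, 'p, 'b) fctr" where
  "comma_P2 B = \<lparr>omap = (\<lambda>(e, h). Tgt B h), amap = (\<lambda>(_, (g, u), _). u)\<rparr>"

lemma comma_cat_category:
  assumes "cat_functor E B P"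
  shows "category (comma_cat E B P)"
proof -
  interpret P: cat_functor E B P by fact
  note cl = P.C.Src_Obj P.C.Tgt_Obj P.C.Idt_Arr P.C.Src_Idt P.C.Tgt_Idt P.C.Comp_Arr P.C.Src_Comp
    P.C.Tgt_Comp P.C.Comp_Idt_left P.C.Comp_Idt_right
    P.D.Src_Obj P.D.Tgt_Obj P.D.Idt_Arr P.D.Src_Idt P.D.Tgt_Idt P.D.Comp_Arr P.D.Src_Comp
    P.D.Tgt_Comp P.D.Comp_Idt_left P.D.Comp_Idt_right
    P.omap_Obj P.amap_Arr P.Src_amap P.Tgt_amap P.amap_Idt P.amap_Comp
  have id_r: "Comp B h (Idt B x) = h" if "h \<in> Arr B" "Src B h = x" for h x
    using P.D.Comp_Idt_right that by metis
  have id_l: "Comp B (Idt B x) h = h" if "h \<in> Arr B" "Tgt B h = x" for h x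
    using P.D.Comp_Idt_left that by metis
  have paste: "Comp B (Comp B u' u) h = Comp B (Comp B h'' (amap P g')) (amap P g)"
    if "h \<in> Arr B" "h' \<in> Arr B" "h'' \<in> Arr B" "u \<in> Arr B" "u' \<in> Arr B" "g \<in> Arr E" "g' \<in> Arr E"
      "Src B u = Tgt B h" "Src B u' = Tgt B u" "Tgt B u = Tgt B h'"
      "Src B h' = omap P (Tgt E g)" "Src E g' = Tgt E g" "Src B h'' = omap P (Tgt E g')"
      "Comp B u h = Comp B h' (amap P g)" "Comp B u' h' = Comp B h'' (amap P g')"
    for h h' h'' u u' g g'
  proof -
    have "Comp B (Comp B u' u) h = Comp B u' (Comp B h' (amap P g))"
      using that P.D.Comp_assoc by metis
    also have "\<dots> = Comp B (Comp B h'' (amap P g')) (amap P g)"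
      using that P.D.Comp_assoc[of "amap P g" h' u'] by (simp add: cl)
    finally show ?thesis .
  qed
  show ?thesis
    by unfold_locales
      (auto simp: comma_cat_def Let_def cl id_r id_l P.C.Comp_assoc P.D.Comp_assoc intro!: paste)
qed

lemma comma_P1_functor:
  assumes "cat_functor E B P"
  shows "cat_functor E (comma_cat E B P) (comma_P1 E B P)"
proof -
  interpret P: cat_functor E B P by fact
  interpret K: category "comma_cat E B P" by (rule comma_cat_category) fact
  note cl = P.C.Src_Obj P.C.Tgt_Obj P.C.Idt_Arr P.C.Src_Idt P.C.Tgt_Idt P.C.Comp_Arr P.C.Src_Comp
    P.C.Tgt_Comp P.D.Idt_Arr P.D.Src_Idt P.D.Tgt_Idt
    P.omap_Obj P.amap_Arr P.Src_amap P.Tgt_amap P.amap_Idt P.amap_Comp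
  have "Comp B (amap P g) (Idt B (omap P (Src E g))) = Comp B (Idt B (omap P (Tgt E g))) (amap P g)"
    if "g \<in> Arr E" for g
    using that P.D.Comp_Idt_left[of "amap P g"] P.D.Comp_Idt_right[of "amap P g"] by (simp add: cl)
  then show ?thesis
    by unfold_locales (auto simp: comma_cat_def comma_P1_def Let_def cl)
qed

lemma comma_P2_functor:
  assumes "cat_functor E B P"
  shows "cat_functor (comma_cat E B P) B (comma_P2 B)"
proof -
  interpret P: cat_functor E B P by fact
  interpret K: category "comma_cat E B P" by (rule comma_cat_category) fact
  show ?thesis
    by unfold_locales (auto simp: comma_cat_def comma_P2_def Let_def P.D.Tgt_Obj)
qed

end

theory Submission imports Defs begin

text \<open>
  On each subcategory \<open>U\<close>, a lax section of \<open>P\<close>, i.e. a functor \<open>s\<close> with \<open>\<tau> : P s \<Rightarrow> \<iota>\<close>, is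
  the same thing as a strict section \<open>x \<mapsto> (s x, \<tau> x)\<close> of \<open>P\<^sub>2\<close>. A strict section of \<open>P\<^sub>2\<close> is lax
  via the identity transformation, and a lax section \<open>x \<mapsto> (e x, h x)\<close> of \<open>P\<^sub>2\<close> with
  transformation \<open>\<tau>\<close> yields the lax section \<open>e\<close> of \<open>P\<close> with transformation \<open>\<tau> x \<circ> h x\<close>. So the same
  covers are admissible for all three invariants.
\<close>

lemma fctr_comp_simps [simp]:
  "omap (G \<circ>\<^sub>F F) x = omap G (omap F x)"
  "amap (G \<circ>\<^sub>F F) f = amap G (amap F f)"
  by (simp_all add: fctr_comp_def)

lemma incl_simps [simp]: "omap incl x = x" "amap incl f = f"
  by (simp_all add: incl_def)

lemma cat_functor_comp:
  assumes "cat_functor C D F" "cat_functor D K G"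
  shows "cat_functor C K (G \<circ>\<^sub>F F)"
proof -
  interpret F: cat_functor C D F by fact
  interpret G: cat_functor D K G by fact
  show ?thesis
    by unfold_locales
      (simp_all add: F.omap_Obj F.amap_Arr F.Src_amap F.Tgt_amap F.amap_Idt F.amap_Comp
        G.omap_Obj G.amap_Arr G.Src_amap G.Tgt_amap G.amap_Idt G.amap_Comp)
qed

lemma cat_functor_incl:
  assumes "subcategory U B"
  shows "cat_functor U B incl"
proof -
  interpret U: category U using assms by (simp add: subcategory_def)
  interpret B: category B using assms by (simp add: subcategory_def)
  show ?thesis
    using assms by unfold_locales (auto simp: subcategory_def)
qed

text \<open>\<open>fctr_eq\<close> only compares values on the carriers, so \<open>F\<close> and
  \<open>G\<close> may differ as records; the identity transformation between them therefore has to
  be written out.\<close>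

lemma nat_transf_of_fctr_eq:
  assumes "cat_functor C D F" "cat_functor C D G" "fctr_eq C F G"
  shows "nat_transf C D F G (\<lambda>x. Idt D (omap G x))"
proof -
  interpret F: cat_functor C D F by fact
  interpret G: cat_functor C D G by fact
  have eq: "omap F x = omap G x" if "x \<in> Obj C" for x
    using assms(3) that by (simp add: fctr_eq_def)
  have eqa: "amap F f = amap G f" if "f \<in> Arr C" for f
    using assms(3) that by (simp add: fctr_eq_def)
  have "Comp D (Idt D (omap G (Tgt C f))) (amap F f) = Comp D (amap G f) (Idt D (omap G (Src C f)))"
    if "f \<in> Arr C" for f
    using that F.D.Comp_Idt_left[of "amap G f"] F.D.Comp_Idt_right[of "amap G f"]
    by (simp add: eqa G.amap_Arr G.Src_amap G.Tgt_amap)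
  then show ?thesis
    by unfold_locales
      (simp_all add: eq G.omap_Obj F.D.Idt_Arr F.D.Src_Idt F.D.Tgt_Idt)
qed

definition comma_fst :: "(('o, 'b) comma_obj, ('o, 'a, 'b) comma_arr, 'o, 'a) fctr" where
  "comma_fst = \<lparr>omap = fst, amap = (\<lambda>(_, (g, u), _). g)\<rparr>"

lemma comma_fst_functor:
  assumes "cat_functor E B P"
  shows "cat_functor (comma_cat E B P) E comma_fst"
proof -
  interpret P: cat_functor E B P by fact
  interpret K: category "comma_cat E B P" by (rule comma_cat_category) fact
  show ?thesis
    by unfold_locales (auto simp: comma_cat_def comma_fst_def Let_def)
qed

lemma comma_P2_comp_P1:
  assumes "cat_functor E B P"
  shows "fctr_eq E (comma_P2 B \<circ>\<^sub>F comma_P1 E B P) P"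
proof -
  interpret P: cat_functor E B P by fact
  show ?thesis
    by (auto simp: fctr_eq_def comma_P2_def comma_P1_def Let_def P.omap_Obj P.D.Tgt_Idt)
qed

text \<open>This is the universal 2-cell of the comma category: its component at
  \<open>(e, h)\<close> is \<open>h\<close>, and its naturality square is the commutation condition
  imposed on an arrow \<open>(g, u)\<close>.\<close>

lemma comma_nat_transf:
  assumes "cat_functor E B P"
  shows "nat_transf (comma_cat E B P) B (P \<circ>\<^sub>F comma_fst) (comma_P2 B) snd"
proof -
  interpret F: cat_functor "comma_cat E B P" B "P \<circ>\<^sub>F comma_fst"
    by (rule cat_functor_comp[OF comma_fst_functor[OF assms] assms])
  interpret G: cat_functor "comma_cat E B P" B "comma_P2 B"
    by (rule comma_P2_functor[OF assms])
  show ?thesis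
    by unfold_locales (auto simp: comma_cat_def comma_P2_def comma_fst_def Let_def)
qed

text \<open>Whiskering, used to restrict the universal 2-cell along a section.\<close>

lemma nat_transf_comp_right:
  assumes "cat_functor A C S" "nat_transf C D F G \<tau>"
  shows "nat_transf A D (F \<circ>\<^sub>F S) (G \<circ>\<^sub>F S) (\<lambda>x. \<tau> (omap S x))"
proof -
  interpret S: cat_functor A C S by fact
  interpret T: nat_transf C D F G \<tau> by fact
  interpret FS: cat_functor A D "F \<circ>\<^sub>F S"
    by (rule cat_functor_comp) unfold_locales
  interpret GS: cat_functor A D "G \<circ>\<^sub>F S"
    by (rule cat_functor_comp) unfold_locales
  have "Comp D (\<tau> (omap S (Tgt A f))) (amap F (amap S f))
      = Comp D (amap G (amap S f)) (\<tau> (omap S (Src A f)))" if "f \<in> Arr A" for f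
    using T.naturality[of "amap S f"] that by (simp add: S.amap_Arr S.Src_amap S.Tgt_amap)
  then show ?thesis
    by unfold_locales
      (simp_all add: T.\<tau>_Arr T.Src_\<tau> T.Tgt_\<tau> S.omap_Obj)
qed

lemma nat_transf_vcomp:
  assumes "nat_transf C D F G \<sigma>" "nat_transf C D G H \<tau>"
  shows "nat_transf C D F H (\<lambda>x. Comp D (\<tau> x) (\<sigma> x))"
proof -
  interpret S: nat_transf C D F G \<sigma> by fact
  interpret T: nat_transf C D G H \<tau> by fact
  note cl = S.\<tau>_Arr S.Src_\<tau> S.Tgt_\<tau> T.\<tau>_Arr T.Src_\<tau> T.Tgt_\<tau>
    S.F.C.Src_Obj S.F.C.Tgt_Obj S.F.amap_Arr S.F.Src_amap S.F.Tgt_amap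
    S.G.amap_Arr S.G.Src_amap S.G.Tgt_amap T.G.amap_Arr T.G.Src_amap T.G.Tgt_amap
  have "Comp D (Comp D (\<tau> (Tgt C f)) (\<sigma> (Tgt C f))) (amap F f)
      = Comp D (amap H f) (Comp D (\<tau> (Src C f)) (\<sigma> (Src C f)))" if f: "f \<in> Arr C" for f
  proof -
    \<comment> \<open>The arrow \<open>f\<close> is moved past \<open>\<sigma>\<close> first and
      then past \<open>\<tau>\<close>, reassociating in between.\<close>
    have "Comp D (Comp D (\<tau> (Tgt C f)) (\<sigma> (Tgt C f))) (amap F f)
        = Comp D (\<tau> (Tgt C f)) (Comp D (amap G f) (\<sigma> (Src C f)))"
      using f by (simp add: cl S.F.D.Comp_assoc[symmetric] S.naturality[symmetric])
    also have "\<dots> = Comp D (Comp D (amap H f) (\<tau> (Src C f))) (\<sigma> (Src C f))"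
      using f by (simp add: cl S.F.D.Comp_assoc T.naturality)
    also have "\<dots> = Comp D (amap H f) (Comp D (\<tau> (Src C f)) (\<sigma> (Src C f)))"
      using f by (simp add: cl S.F.D.Comp_assoc)
    finally show ?thesis .
  qed
  then show ?thesis
    by unfold_locales
      (simp_all add: cl S.F.D.Comp_Arr S.F.D.Src_Comp S.F.D.Tgt_Comp)
qed

text \<open>The functor induced by the universal property of the comma category. \<open>G\<close>
  enters on arrows only: on objects its value is recovered as the target of
  \<open>\<tau> x\<close>.\<close>

definition comma_lift ::
    "('q, 'c) cat \<Rightarrow> ('q, 'c, 'o, 'a) fctr \<Rightarrow> ('q, 'c, 'p, 'b) fctr \<Rightarrow> ('q \<Rightarrow> 'b)
      \<Rightarrow> ('q, 'c, ('o, 'b) comma_obj, ('o, 'a, 'b) comma_arr) fctr" where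
  "comma_lift U S G \<tau> =
    \<lparr>omap = (\<lambda>x. (omap S x, \<tau> x)),
     amap = (\<lambda>f. ((omap S (Src U f), \<tau> (Src U f)), (amap S f, amap G f),
       (omap S (Tgt U f), \<tau> (Tgt U f))))\<rparr>"

text \<open>Naturality of \<open>\<tau>\<close> at \<open>f\<close> is exactly the equation that
  makes \<open>(amap S f, amap G f)\<close> an arrow of the comma category.\<close>

lemma
  assumes "cat_functor E B P" "cat_functor U E S" "nat_transf U B (P \<circ>\<^sub>F S) G \<tau>"
  shows comma_lift_functor: "cat_functor U (comma_cat E B P) (comma_lift U S G \<tau>)"
    and comma_P2_comp_lift: "fctr_eq U (comma_P2 B \<circ>\<^sub>F comma_lift U S G \<tau>) G"
proof -
  interpret P: cat_functor E B P by fact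
  interpret S: cat_functor U E S by fact
  interpret T: nat_transf U B "P \<circ>\<^sub>F S" G \<tau> by fact
  interpret K: category "comma_cat E B P" by (rule comma_cat_category) fact
  note cl = S.omap_Obj S.amap_Arr S.Src_amap S.Tgt_amap S.amap_Idt S.amap_Comp
    T.G.amap_Arr T.G.Src_amap T.G.Tgt_amap T.G.amap_Idt T.G.amap_Comp
    S.C.Src_Obj S.C.Tgt_Obj S.C.Src_Idt S.C.Tgt_Idt S.C.Src_Comp S.C.Tgt_Comp
  have \<tau>: "\<tau> x \<in> Arr B" "Src B (\<tau> x) = omap P (omap S x)" "Tgt B (\<tau> x) = omap G x"
    if "x \<in> Obj U" for x
    using T.\<tau>_Arr T.Src_\<tau> T.Tgt_\<tau> that by simp_all
  show "cat_functor U (comma_cat E B P) (comma_lift U S G \<tau>)"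
    by unfold_locales
      (use T.naturality in \<open>simp_all add: comma_cat_def comma_lift_def Let_def cl \<tau>\<close>)
  show "fctr_eq U (comma_P2 B \<circ>\<^sub>F comma_lift U S G \<tau>) G"
    by (simp add: fctr_eq_def comma_P2_def comma_lift_def \<tau>)
qed

text \<open>This predicate and the next copy the condition on one cover member from
  \<open>secat\<close> and \<open>dsecat\<close>, so that folding them there reduces the theorem to
  a comparison of predicates.\<close>

definition strict_section where
  "strict_section E Q U \<longleftrightarrow> (\<exists>s. cat_functor U E s \<and> fctr_eq U (Q \<circ>\<^sub>F s) incl)"

definition lax_section where
  "lax_section E B Q U \<longleftrightarrow>
    (\<exists>s. cat_functor U E s \<and> (\<exists>\<tau>. nat_transf U B (Q \<circ>\<^sub>F s) incl \<tau>))"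

lemma lax_section_of_strict:
  assumes "subcategory U B" "cat_functor E B Q" "strict_section E Q U"
  shows "lax_section E B Q U"
  using assms nat_transf_of_fctr_eq[OF cat_functor_comp cat_functor_incl]
  unfolding lax_section_def strict_section_def by blast

lemma strict_section_comma_of_lax:
  assumes "cat_functor E B P" "lax_section E B P U"
  shows "strict_section (comma_cat E B P) (comma_P2 B) U"
  using assms comma_lift_functor comma_P2_comp_lift
  unfolding lax_section_def strict_section_def by blast

lemma fctr_comp_assoc: "(H \<circ>\<^sub>F G) \<circ>\<^sub>F F = H \<circ>\<^sub>F (G \<circ>\<^sub>F F)"
  by (simp add: fctr_comp_def comp_assoc)

lemma lax_section_of_lax_comma:
  assumes "cat_functor E B P" "lax_section (comma_cat E B P) B (comma_P2 B) U"
  shows "lax_section E B P U"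
proof -
  obtain s \<tau> where s: "cat_functor U (comma_cat E B P) s"
    and \<tau>: "nat_transf U B (comma_P2 B \<circ>\<^sub>F s) incl \<tau>"
    using assms(2) unfolding lax_section_def by blast
  \<comment> \<open>The 2-cell whiskered with \<open>s\<close> goes from
    \<open>P \<circ>\<^sub>F comma_fst \<circ>\<^sub>F s\<close> to
    \<open>comma_P2 B \<circ>\<^sub>F s\<close>, and \<open>\<tau>\<close> continues to the
    inclusion.\<close>
  have "nat_transf U B (P \<circ>\<^sub>F (comma_fst \<circ>\<^sub>F s)) incl (\<lambda>x. Comp B (\<tau> x) (snd (omap s x)))"
    using nat_transf_vcomp[OF nat_transf_comp_right[OF s comma_nat_transf[OF assms(1)]] \<tau>]
    by (simp add: fctr_comp_assoc)
  then show ?thesis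
    using cat_functor_comp[OF s comma_fst_functor[OF assms(1)]] unfolding lax_section_def by blast
qed

theorem corollary6p8:
  fixes E :: "('o, 'a) cat" and B :: "('p, 'b) cat" and P :: "('o, 'a, 'p, 'b) fctr"
  assumes "cat_functor E B P"
  shows "fctr_eq E (comma_P2 B \<circ>\<^sub>F comma_P1 E B P) P
    \<and> dsecat E B P = dsecat (comma_cat E B P) B (comma_P2 B)
    \<and> dsecat (comma_cat E B P) B (comma_P2 B) = secat (comma_cat E B P) B (comma_P2 B)"
proof -
  let ?K = "comma_cat E B P" and ?Q = "comma_P2 B"
  \<comment> \<open>Both equivalences come from one cycle: lax for \<open>P\<close>, strict for
    \<open>?Q\<close>, lax for \<open>?Q\<close>, lax for \<open>P\<close>.\<close>
  have lax: "lax_section E B P U \<longleftrightarrow> lax_section ?K B ?Q U"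
    and strict: "lax_section ?K B ?Q U \<longleftrightarrow> strict_section ?K ?Q U"
    if "subcategory U B" for U
    using that assms lax_section_of_strict[OF _ comma_P2_functor] strict_section_comma_of_lax
      lax_section_of_lax_comma by blast+
  \<comment> \<open>The cover condition stays on both sides because it supplies
    \<open>subcategory (U i) B\<close>, under which the equivalences were shown; the sets under each
    \<open>Inf\<close> then coincide.\<close>
  have "is_cover B {0..n} U \<and> (\<forall>i\<in>{0..n}. lax_section E B P (U i)) \<longleftrightarrow>
      is_cover B {0..n} U \<and> (\<forall>i\<in>{0..n}. lax_section ?K B ?Q (U i))"
    and "is_cover B {0..n} U \<and> (\<forall>i\<in>{0..n}. lax_section ?K B ?Q (U i)) \<longleftrightarrow>
      is_cover B {0..n} U \<and> (\<forall>i\<in>{0..n}. strict_section ?K ?Q (U i))" for n :: nat and U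
    using lax strict unfolding is_cover_def by blast+
  then show ?thesis
    using comma_P2_comp_P1[OF assms]
    unfolding dsecat_def secat_def lax_section_def[symmetric] strict_section_def[symmetric]
    by simp
qed

end
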